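(* Let $\mathcal{C}$ be a set of positive integers and let $\mathcal{P}$ be the class of graphs having no hole whose length belongs to $\mathcal{C}$. If $\mathcal{P}$ is expressible by forbidden orientations, then at least one of the following holds: (1) $\mathcal{C}$ is finite; (2) there is a positive integer $M$ such that $\mathcal{C}_M$ is the set of odd integers greater than or equal to $M$ (equivalently, $cyc(\mathcal{P})_M$ is the set of even integers greater than or equal to $M$).
   Context: Graphs are finite and simple; $C_k$ is the cycle with $k$ vertices. A hole is an induced cycle of length at least four. An oriented graph is a digraph without loops, parallel arcs or pairs of opposite arcs; an orientation assigns a direction to each edge. For a set $F$ of oriented graphs, an oriented graph is $F$-free if no member of $F$ is isomorphic to an induced subdigraph of it. A graph class $\mathcal{P}$ is expressible by forbidden orientations if there is a finite set $F$ of oriented graphs such that a graph belongs to $\mathcal{P}$ iff it admits an $F$-free orientation. $cyc(\mathcal{P})$ is the set of integers $k\ge3$ with $C_k\in\mathcal{P}$; for a set $B$ of integers, $B_M=\{b\in B:b\ge M\}$. *)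

theory Defs
  imports "Graph_Theory.Graph_Theory"
begin

text \<open>
  Finite simple graphs are symmetric loop-free pair digraphs (\<^locale>\<open>pair_graph\<close>). Graph classes
  are sets of graphs with vertices in \<^typ>\<open>nat\<close>, which represents every finite graph up to
  isomorphism.
\<close>

locale oriented_graph = pair_digraph +
  assumes no_opposite_arcs: "(u, v) \<in> parcs G \<Longrightarrow> (v, u) \<notin> parcs G"

definition orientation_of :: "'a pair_pre_digraph \<Rightarrow> 'a pair_pre_digraph \<Rightarrow> bool" where
  "orientation_of D G \<longleftrightarrow> oriented_graph D \<and> mk_symmetric (with_proj D) = G"

definition has_induced_copy :: "'a pair_pre_digraph \<Rightarrow> 'b pair_pre_digraph \<Rightarrow> bool" where
  "has_induced_copy G H \<longleftrightarrow>
     (\<exists>K. induced_subgraph (with_proj K) (with_proj G) \<and> digraph_iso (with_proj H) (with_proj K))"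

definition free_of :: "'b pair_pre_digraph set \<Rightarrow> 'a pair_pre_digraph \<Rightarrow> bool" where
  "free_of F D \<longleftrightarrow> (\<forall>H\<in>F. \<not> has_induced_copy D H)"

definition expressible_by_forbidden_orientations :: "nat pair_pre_digraph set \<Rightarrow> bool" where
  "expressible_by_forbidden_orientations P \<longleftrightarrow>
     (\<exists>F :: nat pair_pre_digraph set. finite F \<and> (\<forall>H\<in>F. oriented_graph H) \<and>
        (\<forall>G. pair_graph G \<longrightarrow> (G \<in> P \<longleftrightarrow> (\<exists>D. orientation_of D G \<and> free_of F D))))"

text \<open>Only meaningful for \<open>k \<ge> 3\<close>.\<close>
definition cycle_graph :: "nat \<Rightarrow> nat pair_pre_digraph" where
  "cycle_graph k =
     \<lparr> pverts = {..<k},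
       parcs = {(i, j). i < k \<and> j < k \<and> (j = (i + 1) mod k \<or> i = (j + 1) mod k)} \<rparr>"

definition has_hole :: "'a pair_pre_digraph \<Rightarrow> nat \<Rightarrow> bool" where
  "has_hole G k \<longleftrightarrow> k \<ge> 4 \<and> has_induced_copy G (cycle_graph k)"

definition graphs_without_holes :: "nat set \<Rightarrow> nat pair_pre_digraph set" where
  "graphs_without_holes C = {G. pair_graph G \<and> (\<forall>c\<in>C. \<not> has_hole G c)}"

definition cyc :: "nat pair_pre_digraph set \<Rightarrow> nat set" where
  "cyc P = {k. k \<ge> 3 \<and> cycle_graph k \<in> P}"

definition from_on :: "nat set \<Rightarrow> nat \<Rightarrow> nat set" where
  "from_on B M = {b \<in> B. b \<ge> M}"

end

theory Submission
  imports Defs "HOL-Library.Cardinality" "HOL-Library.FuncSet"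
begin

text \<open>
  Let \<open>N\<close> bound the number of vertices of the forbidden oriented graphs. An orientation of a cycle of
  length \<open>q > N\<close> is free of them as soon as all its windows of \<open>N\<close> consecutive vertices occur as
  induced oriented paths, in sufficiently many disjoint copies, in some free oriented graph. Many
  identically oriented copies of a graph \<open>G\<close> of the class are obtained by pigeonhole from a free
  orientation of a large disjoint union of copies of \<open>G\<close>.

  For \<open>G\<close> a long path, a repeated window yields one cycle of length greater than \<open>N\<close> in the class.
  If \<open>k, k' > N\<close> are lengths of cycles in the class, let \<open>G\<close> consist of two such cycles joined by a path
  of arbitrary length. The closed walk around the first cycle, along the path, around the second cycle
  and back has length \<open>k + k' + 2 * l + 2\<close> and its short windows are induced paths, so the cycles of
  all these lengths lie in the class. With \<open>k = k'\<close> this gives all large even lengths; with \<open>k\<close> even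
  and \<open>k'\<close> odd, a single large odd length gives all large odd lengths.
\<close>

section \<open>Induced copies\<close>

lemma pair_wf_digraph_iff: "pair_wf_digraph G \<longleftrightarrow> parcs G \<subseteq> pverts G \<times> pverts G"
  by (auto simp: pair_wf_digraph_def)

definition induced_embedding :: "('a \<Rightarrow> 'b) \<Rightarrow> 'a pair_pre_digraph \<Rightarrow> 'b pair_pre_digraph \<Rightarrow> bool" where
  "induced_embedding f H D \<longleftrightarrow> inj_on f (pverts H) \<and> f ` pverts H \<subseteq> pverts D \<and>
     (\<forall>u\<in>pverts H. \<forall>v\<in>pverts H. (u, v) \<in> parcs H \<longleftrightarrow> (f u, f v) \<in> parcs D)"

lemma induced_embeddingI:
  assumes "inj_on f (pverts H)" "\<And>u. u \<in> pverts H \<Longrightarrow> f u \<in> pverts D"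
    and "\<And>u v. u \<in> pverts H \<Longrightarrow> v \<in> pverts H \<Longrightarrow> (u, v) \<in> parcs H \<longleftrightarrow> (f u, f v) \<in> parcs D"
  shows "induced_embedding f H D"
  using assms by (auto simp: induced_embedding_def)

lemma induced_embeddingD:
  assumes "induced_embedding f H D"
  shows "inj_on f (pverts H)" "u \<in> pverts H \<Longrightarrow> f u \<in> pverts D"
    and "u \<in> pverts H \<Longrightarrow> v \<in> pverts H \<Longrightarrow> (u, v) \<in> parcs H \<longleftrightarrow> (f u, f v) \<in> parcs D"
  using assms by (auto simp: induced_embedding_def)

lemma induced_embedding_id: "induced_embedding id D D"
  by (simp add: induced_embedding_def)

lemma induced_embedding_comp:
  assumes "induced_embedding f H K" "induced_embedding g K D"
  shows "induced_embedding (g \<circ> f) H D"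
proof -
  have "inj_on g (f ` pverts H)"
    using assms by (auto simp: induced_embedding_def intro: inj_on_subset)
  then show ?thesis
    using assms by (auto simp: induced_embedding_def image_subset_iff intro!: comp_inj_on)
qed

lemma induced_embedding_inv_into:
  assumes "induced_embedding f H D" "f ` pverts H = pverts D"
  shows "induced_embedding (inv_into (pverts H) f) D H"
proof (rule induced_embeddingI)
  show "inj_on (inv_into (pverts H) f) (pverts D)"
    using assms(2) by (auto intro: inj_on_inv_into)
  show inv_mem: "inv_into (pverts H) f u \<in> pverts H" if "u \<in> pverts D" for u
    using that assms(2) by (auto intro: inv_into_into)
  show "(u, v) \<in> parcs D \<longleftrightarrow> (inv_into (pverts H) f u, inv_into (pverts H) f v) \<in> parcs H"
    if "u \<in> pverts D" "v \<in> pverts D" for u v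
    using induced_embeddingD(3)[OF assms(1) inv_mem inv_mem] that assms(2) by (simp add: f_inv_into_f)
qed

lemma induced_embedding_image_parcs:
  assumes "pair_wf_digraph H" "induced_embedding f H D"
  shows "map_prod f f ` parcs H = {e \<in> parcs D. fst e \<in> f ` pverts H \<and> snd e \<in> f ` pverts H}"
proof (intro subset_antisym subsetI)
  fix e assume "e \<in> map_prod f f ` parcs H"
  then obtain u v where "(u, v) \<in> parcs H" "u \<in> pverts H" "v \<in> pverts H" "e = (f u, f v)"
    using assms(1) by (auto simp: pair_wf_digraph_iff)
  then show "e \<in> {e \<in> parcs D. fst e \<in> f ` pverts H \<and> snd e \<in> f ` pverts H}"
    using induced_embeddingD(3)[OF assms(2), of u v] by simp
next
  fix e assume "e \<in> {e \<in> parcs D. fst e \<in> f ` pverts H \<and> snd e \<in> f ` pverts H}"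
  then obtain u v where "u \<in> pverts H" "v \<in> pverts H" "e = (f u, f v)" "e \<in> parcs D"
    by (cases e) auto
  then have "(u, v) \<in> parcs H"
    using induced_embeddingD(3)[OF assms(2), of u v] by simp
  then show "e \<in> map_prod f f ` parcs H"
    using \<open>e = (f u, f v)\<close> by (auto intro: rev_image_eqI)
qed

lemma digraph_isomorphism_arc_eq:
  assumes "pre_digraph.digraph_isomorphism (with_proj H) h"
    and "with_proj K = app_iso h (with_proj H)" and "(u, v) \<in> parcs H"
  shows "iso_arcs h (u, v) = (iso_verts h u, iso_verts h v)"
proof -
  have "iso_tail h = fst" "iso_head h = snd"
    using assms(2) by (simp_all add: app_iso_def with_proj_def)
  then show ?thesis
    using assms(1,3) by (force simp: pre_digraph.digraph_isomorphism_def intro: prod_eqI)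
qed

lemma has_induced_copy_imp_induced_embedding:
  assumes "has_induced_copy D H"
  shows "\<exists>f. induced_embedding f H D"
proof -
  from assms obtain K h where induced: "induced_subgraph (with_proj K) (with_proj D)"
    and iso: "pre_digraph.digraph_isomorphism (with_proj H) h" "with_proj K = app_iso h (with_proj H)"
    by (auto simp: has_induced_copy_def digraph_iso_def)
  let ?f = "iso_verts h"
  have wf: "pair_wf_digraph H" and inj: "inj_on ?f (pverts H)"
    using iso(1) by (auto simp: pre_digraph.digraph_isomorphism_def wf_digraph_wp_iff)
  have "parcs K = iso_arcs h ` parcs H"
    using iso(2) by (simp add: app_iso_def with_proj_def)
  also have "\<dots> = map_prod ?f ?f ` parcs H"
    using digraph_isomorphism_arc_eq[OF iso] by (auto intro!: image_cong)
  finally have K_arcs: "parcs K = map_prod ?f ?f ` parcs H" .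
  have K_verts: "pverts K = ?f ` pverts H"
    using iso(2) by (simp add: app_iso_def with_proj_def)
  have K_sub: "pverts K \<subseteq> pverts D" "parcs K = {e \<in> parcs D. fst e \<in> pverts K \<and> snd e \<in> pverts K}"
    using induced by (auto simp: induced_subgraph_def subgraph_def)
  have "induced_embedding ?f H D"
  proof (rule induced_embeddingI[OF inj])
    show "?f u \<in> pverts D" if "u \<in> pverts H" for u
      using that K_sub(1) K_verts by blast
    fix u v assume uv: "u \<in> pverts H" "v \<in> pverts H"
    have "(u, v) \<in> parcs H \<longleftrightarrow> map_prod ?f ?f (u, v) \<in> parcs K"
      unfolding K_arcs
      using uv wf inj_on_image_mem_iff[OF map_prod_inj_on[OF inj inj], of "(u, v)"]
      by (simp add: pair_wf_digraph_iff)
    also have "\<dots> \<longleftrightarrow> (?f u, ?f v) \<in> parcs D"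
      using uv K_verts K_sub(2) by simp
    finally show "(u, v) \<in> parcs H \<longleftrightarrow> (?f u, ?f v) \<in> parcs D" .
  qed
  then show ?thesis by blast
qed

lemma induced_embedding_imp_has_induced_copy:
  assumes "pair_wf_digraph H" "pair_wf_digraph D" "induced_embedding f H D"
  shows "has_induced_copy D H"
proof -
  define h where "h = \<lparr>iso_verts = f, iso_arcs = map_prod f f, iso_head = snd, iso_tail = fst\<rparr>"
  define K where "K = \<lparr>pverts = f ` pverts H, parcs = map_prod f f ` parcs H\<rparr>"
  have "inj_on (map_prod f f) (parcs H)"
    using assms(1) map_prod_inj_on[OF induced_embeddingD(1,1)[OF assms(3)]]
    by (auto simp: pair_wf_digraph_iff intro: inj_on_subset)
  then have "pre_digraph.digraph_isomorphism (with_proj H) h"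
    using assms
    by (auto simp: pre_digraph.digraph_isomorphism_def h_def wf_digraph_wp_iff induced_embedding_def)
  moreover have "with_proj K = app_iso h (with_proj H)"
    by (simp add: with_proj_def app_iso_def K_def h_def)
  ultimately have "digraph_iso (with_proj H) (with_proj K)"
    by (auto simp: digraph_iso_def)
  moreover have "induced_subgraph (with_proj K) (with_proj D)"
  proof -
    have "parcs K = {e \<in> parcs D. fst e \<in> pverts K \<and> snd e \<in> pverts K}"
      using induced_embedding_image_parcs[OF assms(1,3)] by (simp add: K_def)
    moreover have "pverts K \<subseteq> pverts D"
      using assms(3) by (simp add: K_def induced_embedding_def)
    moreover have "pair_wf_digraph K"
      using assms(1) by (auto simp: K_def pair_wf_digraph_iff)
    ultimately show ?thesis
      using assms(2)
      by (auto simp: induced_subgraph_def subgraph_def compatible_def wf_digraph_wp_iff)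
  qed
  ultimately show ?thesis
    by (auto simp: has_induced_copy_def)
qed

lemma has_induced_copy_iff:
  "has_induced_copy D H \<longleftrightarrow>
     pair_wf_digraph D \<and> pair_wf_digraph H \<and> (\<exists>f. induced_embedding f H D)"
proof
  assume copy: "has_induced_copy D H"
  then have "pair_wf_digraph D" "pair_wf_digraph H"
    by (auto simp: has_induced_copy_def induced_subgraph_def subgraph_def digraph_iso_def
        pre_digraph.digraph_isomorphism_def wf_digraph_wp_iff)
  with has_induced_copy_imp_induced_embedding[OF copy]
  show "pair_wf_digraph D \<and> pair_wf_digraph H \<and> (\<exists>f. induced_embedding f H D)" by simp
qed (auto intro: induced_embedding_imp_has_induced_copy)

lemma has_induced_copy_trans:
  "has_induced_copy D K \<Longrightarrow> has_induced_copy K H \<Longrightarrow> has_induced_copy D H"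
  unfolding has_induced_copy_iff using induced_embedding_comp by blast

lemma free_of_induced_copy: "free_of F D \<Longrightarrow> has_induced_copy D K \<Longrightarrow> free_of F K"
  unfolding free_of_def using has_induced_copy_trans by blast

section \<open>Orientations\<close>

lemma pair_digraph_iff:
  "pair_digraph G \<longleftrightarrow> finite (pverts G) \<and> parcs G \<subseteq> pverts G \<times> pverts G \<and> irrefl (parcs G)"
  by (auto simp: pair_digraph_def pair_fin_digraph_def pair_fin_digraph_axioms_def
      pair_loopfree_digraph_def pair_loopfree_digraph_axioms_def pair_wf_digraph_iff irrefl_def
      intro: finite_subset)

lemma pair_graph_iff:
  "pair_graph G \<longleftrightarrow>
     finite (pverts G) \<and> parcs G \<subseteq> pverts G \<times> pverts G \<and> irrefl (parcs G) \<and> sym (parcs G)"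
proof -
  have "pair_graph G \<longleftrightarrow> pair_digraph G \<and> sym (parcs G)"
    by (auto simp: pair_graph_def pair_pseudo_graph_def pair_sym_digraph_def
        pair_sym_digraph_axioms_def symmetric_def pair_digraph_def pair_fin_digraph_def)
  then show ?thesis by (simp add: pair_digraph_iff)
qed

lemma oriented_graph_iff:
  "oriented_graph D \<longleftrightarrow> finite (pverts D) \<and> parcs D \<subseteq> pverts D \<times> pverts D \<and> asym (parcs D)"
proof -
  have "irrefl (parcs D)" if "asym (parcs D)"
    using that by (auto intro: irreflI dest: asymD)
  moreover have "oriented_graph_axioms D \<longleftrightarrow> asym (parcs D)"
    by (auto simp: oriented_graph_axioms_def intro: asymI dest: asymD)
  ultimately show ?thesis
    by (auto simp: oriented_graph_def pair_digraph_iff)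
qed

lemma pair_graph_imp_pair_wf_digraph: "pair_graph G \<Longrightarrow> pair_wf_digraph G"
  by (simp add: pair_graph_iff pair_wf_digraph_iff)

lemma oriented_graph_imp_pair_wf_digraph: "oriented_graph D \<Longrightarrow> pair_wf_digraph D"
  by (simp add: oriented_graph_iff pair_wf_digraph_iff)

lemma orientation_of_iff:
  "orientation_of D G \<longleftrightarrow> oriented_graph D \<and> pverts D = pverts G \<and> parcs G = parcs D \<union> (parcs D)\<inverse>"
proof -
  have "parcs (mk_symmetric (with_proj D)) = parcs D \<union> (parcs D)\<inverse>"
    unfolding parcs_mk_symmetric by force
  then show ?thesis
    unfolding orientation_of_def by (auto intro: pair_pre_digraph.equality)
qed

lemma finite_orientations:
  assumes "pair_graph G"
  shows "finite {D. orientation_of D G}"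
proof (rule finite_subset)
  show "{D. orientation_of D G} \<subseteq> (\<lambda>A. \<lparr>pverts = pverts G, parcs = A\<rparr>) ` Pow (parcs G)"
  proof
    fix D assume "D \<in> {D. orientation_of D G}"
    then have "D = \<lparr>pverts = pverts G, parcs = parcs D\<rparr>" "parcs D \<in> Pow (parcs G)"
      by (auto simp: orientation_of_iff)
    then show "D \<in> (\<lambda>A. \<lparr>pverts = pverts G, parcs = A\<rparr>) ` Pow (parcs G)" by (rule image_eqI)
  qed
  have "finite (parcs G)"
    using assms by (auto simp: pair_graph_iff intro: finite_subset)
  then show "finite ((\<lambda>A. \<lparr>pverts = pverts G, parcs = A\<rparr>) ` Pow (parcs G))" by simp
qed

definition pullback :: "('a \<Rightarrow> 'b) \<Rightarrow> 'a set \<Rightarrow> 'b pair_pre_digraph \<Rightarrow> 'a pair_pre_digraph" where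
  "pullback f V D = \<lparr>pverts = V, parcs = {(u, v) \<in> V \<times> V. (f u, f v) \<in> parcs D}\<rparr>"

lemma pverts_pullback [simp]: "pverts (pullback f V D) = V"
  by (simp add: pullback_def)

lemma in_parcs_pullback_iff [simp]:
  "(u, v) \<in> parcs (pullback f V D) \<longleftrightarrow> u \<in> V \<and> v \<in> V \<and> (f u, f v) \<in> parcs D"
  by (simp add: pullback_def)

lemma pair_graph_pullback: "pair_graph G \<Longrightarrow> finite V \<Longrightarrow> pair_graph (pullback f V G)"
  by (auto simp: pair_graph_iff irrefl_def sym_def)

lemma oriented_graph_pullback:
  "oriented_graph D \<Longrightarrow> finite V \<Longrightarrow> oriented_graph (pullback f V D)"
  by (auto simp: oriented_graph_iff asym_iff)

lemma has_induced_copy_pullback: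
  assumes "pair_wf_digraph D" "inj_on f V" "f ` V \<subseteq> pverts D"
  shows "has_induced_copy D (pullback f V D)"
proof -
  have "induced_embedding f (pullback f V D) D"
    using assms by (intro induced_embeddingI) auto
  then show ?thesis
    using assms(1) by (auto simp: has_induced_copy_iff pair_wf_digraph_iff)
qed

lemma has_induced_copy_orientation_pullback:
  assumes "induced_embedding f H G" "orientation_of D G"
  shows "has_induced_copy D (pullback f (pverts H) D)"
  using assms
  by (intro has_induced_copy_pullback)
    (auto simp: orientation_of_iff induced_embedding_def oriented_graph_imp_pair_wf_digraph)

lemma orientation_of_pullback:
  assumes "induced_embedding f H G" "pair_wf_digraph H" "orientation_of D G"
  shows "orientation_of (pullback f (pverts H) D) H"
proof -
  have oriented: "oriented_graph D" and verts: "pverts D = pverts G"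
    and arcs: "parcs G = parcs D \<union> (parcs D)\<inverse>"
    using assms(3) by (simp_all add: orientation_of_iff)
  have "finite (pverts H)"
    using assms(1) oriented verts unfolding induced_embedding_def oriented_graph_iff
    by (metis finite_imageD finite_subset)
  then have "oriented_graph (pullback f (pverts H) D)"
    by (rule oriented_graph_pullback[OF oriented])
  moreover have "(u, v) \<in> parcs H \<longleftrightarrow>
      (u, v) \<in> parcs (pullback f (pverts H) D) \<union> (parcs (pullback f (pverts H) D))\<inverse>" for u v
    using assms(2) arcs induced_embeddingD(3)[OF assms(1), of u v] by (auto simp: pair_wf_digraph_iff)
  ultimately show ?thesis
    by (simp add: orientation_of_iff set_eq_iff split_paired_All)
qed

definition admits_free_orientation ::
    "'b pair_pre_digraph set \<Rightarrow> 'a pair_pre_digraph \<Rightarrow> bool" where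
  "admits_free_orientation F G \<longleftrightarrow> (\<exists>D. orientation_of D G \<and> free_of F D)"

lemma admits_free_orientation_induced_copy:
  assumes "admits_free_orientation F G" "has_induced_copy G H"
  shows "admits_free_orientation F H"
proof -
  obtain D where orients: "orientation_of D G" and free: "free_of F D"
    using assms(1) by (auto simp: admits_free_orientation_def)
  obtain f where "induced_embedding f H G" "pair_wf_digraph H"
    using assms(2) by (auto simp: has_induced_copy_iff)
  then have "orientation_of (pullback f (pverts H) D) H" "has_induced_copy D (pullback f (pverts H) D)"
    using orients by (auto intro: orientation_of_pullback has_induced_copy_orientation_pullback)
  with free show ?thesis
    unfolding admits_free_orientation_def by (blast intro: free_of_induced_copy)
qed

section \<open>Disjoint unions\<close>

definition disjoint_union :: "'i set \<Rightarrow> ('i \<Rightarrow> 'a pair_pre_digraph) \<Rightarrow> ('i \<times> 'a) pair_pre_digraph" where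
  "disjoint_union I D =
     \<lparr>pverts = Sigma I (\<lambda>i. pverts (D i)),
      parcs = {((i, u), (j, v)). i \<in> I \<and> i = j \<and> (u, v) \<in> parcs (D i)}\<rparr>"

abbreviation copies :: "nat \<Rightarrow> 'a pair_pre_digraph \<Rightarrow> (nat \<times> 'a) pair_pre_digraph" where
  "copies m G \<equiv> disjoint_union {..<m} (\<lambda>_. G)"

lemma pverts_disjoint_union [simp]: "pverts (disjoint_union I D) = Sigma I (\<lambda>i. pverts (D i))"
  by (simp add: disjoint_union_def)

lemma in_parcs_disjoint_union_iff [simp]:
  "((i, u), (j, v)) \<in> parcs (disjoint_union I D) \<longleftrightarrow> i \<in> I \<and> i = j \<and> (u, v) \<in> parcs (D i)"
  by (simp add: disjoint_union_def)

lemma disjoint_union_cong: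
  "(\<And>i. i \<in> I \<Longrightarrow> D i = D' i) \<Longrightarrow> disjoint_union I D = disjoint_union I D'"
  by (auto simp: disjoint_union_def)

lemma pair_wf_digraph_disjoint_union_iff:
  "pair_wf_digraph (disjoint_union I D) \<longleftrightarrow> (\<forall>i\<in>I. pair_wf_digraph (D i))"
  unfolding pair_wf_digraph_iff subset_iff split_paired_All by auto

lemma pair_graph_disjoint_union:
  assumes "finite I" "\<And>i. i \<in> I \<Longrightarrow> pair_graph (D i)"
  shows "pair_graph (disjoint_union I D)"
proof -
  have "pair_wf_digraph (disjoint_union I D)"
    using assms(2) by (simp add: pair_wf_digraph_disjoint_union_iff pair_graph_imp_pair_wf_digraph)
  with assms show ?thesis
    by (auto simp: pair_graph_iff pair_wf_digraph_iff irrefl_def sym_def)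
qed

lemma has_induced_copy_disjoint_union:
  assumes "\<And>i. i \<in> I \<Longrightarrow> has_induced_copy (D i) (H i)"
  shows "has_induced_copy (disjoint_union I D) (disjoint_union I H)"
proof -
  have "\<forall>i\<in>I. \<exists>f. induced_embedding f (H i) (D i)"
    using assms by (simp add: has_induced_copy_iff)
  then obtain f where emb: "\<And>i. i \<in> I \<Longrightarrow> induced_embedding (f i) (H i) (D i)"
    by metis
  have "induced_embedding (\<lambda>(i, u). (i, f i u)) (disjoint_union I H) (disjoint_union I D)"
  proof (rule induced_embeddingI)
    show "inj_on (\<lambda>(i, u). (i, f i u)) (pverts (disjoint_union I H))"
      using induced_embeddingD(1)[OF emb] by (auto simp: inj_on_def)
  qed (use induced_embeddingD(2,3)[OF emb] in auto)
  then show ?thesis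
    using assms by (auto simp: has_induced_copy_iff pair_wf_digraph_disjoint_union_iff)
qed

lemma induced_embedding_Pair:
  "i \<in> I \<Longrightarrow> induced_embedding (Pair i) (D i) (disjoint_union I D)"
  by (rule induced_embeddingI) (auto intro: inj_onI)

lemma induced_embedding_snd:
  assumes emb: "induced_embedding f H (disjoint_union I D)"
    and "i \<in> I" and component: "\<And>u. u \<in> pverts H \<Longrightarrow> fst (f u) = i"
  shows "induced_embedding (snd \<circ> f) H (D i)"
proof (rule induced_embeddingI)
  have f_eq: "f u = (i, snd (f u))" if "u \<in> pverts H" for u
    using component[OF that] by (simp add: prod_eq_iff)
  show "inj_on (snd \<circ> f) (pverts H)"
    using induced_embeddingD(1)[OF emb] component by (auto simp: inj_on_def prod_eq_iff)
  show "(snd \<circ> f) u \<in> pverts (D i)" if "u \<in> pverts H" for u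
    using induced_embeddingD(2)[OF emb that] component[OF that] by (auto simp: mem_Times_iff)
  fix u v assume "u \<in> pverts H" "v \<in> pverts H"
  then have "(u, v) \<in> parcs H \<longleftrightarrow> ((i, snd (f u)), (i, snd (f v))) \<in> parcs (disjoint_union I D)"
    using induced_embeddingD(3)[OF emb] f_eq by metis
  then show "(u, v) \<in> parcs H \<longleftrightarrow> ((snd \<circ> f) u, (snd \<circ> f) v) \<in> parcs (D i)"
    using \<open>i \<in> I\<close> by simp
qed

lemma has_induced_copy_reindex_disjoint_union:
  assumes "pair_wf_digraph (disjoint_union J D)" "inj_on h I" "h ` I \<subseteq> J"
  shows "has_induced_copy (disjoint_union J D) (disjoint_union I (D \<circ> h))"
proof -
  have "induced_embedding (map_prod h id) (disjoint_union I (D \<circ> h)) (disjoint_union J D)"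
    using assms(2,3) by (intro induced_embeddingI) (auto simp: inj_on_def)
  then show ?thesis
    using assms(1,3) by (auto simp: has_induced_copy_iff pair_wf_digraph_disjoint_union_iff)
qed

lemma orientation_of_disjoint_union_eq:
  assumes "orientation_of D (disjoint_union I G)"
  shows "D = disjoint_union I (\<lambda>i. pullback (Pair i) (pverts (G i)) D)"
proof (rule pair_pre_digraph.equality)
  have verts: "pverts D = Sigma I (\<lambda>i. pverts (G i))" and wf: "parcs D \<subseteq> pverts D \<times> pverts D"
    and arcs: "parcs D \<subseteq> parcs (disjoint_union I G)"
    using assms by (auto simp: orientation_of_iff oriented_graph_iff)
  from verts show "pverts D = pverts (disjoint_union I (\<lambda>i. pullback (Pair i) (pverts (G i)) D))" by simp
  have "i \<in> I \<and> i = j \<and> u \<in> pverts (G i) \<and> v \<in> pverts (G i)"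
    if "((i, u), (j, v)) \<in> parcs D" for i u j v
    using subsetD[OF wf that] subsetD[OF arcs that] verts by auto
  then have "((i, u), (j, v)) \<in> parcs D \<longleftrightarrow>
      ((i, u), (j, v)) \<in> parcs (disjoint_union I (\<lambda>i. pullback (Pair i) (pverts (G i)) D))" for i u j v
    by auto
  then show "parcs D = parcs (disjoint_union I (\<lambda>i. pullback (Pair i) (pverts (G i)) D))"
    unfolding set_eq_iff split_paired_All by blast
qed simp

lemma pigeonhole_card_inj:
  assumes "f \<in> A \<rightarrow> B" "finite A" "finite B" "card B * m < card A"
  obtains b h where "b \<in> B" "inj_on h {..<m}" "h ` {..<m} \<subseteq> f -` {b} \<inter> A"
proof -
  have "A \<noteq> {}" using assms(4) by auto
  then have "B \<noteq> {}" using assms(1) by auto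
  then obtain b where "b \<in> B" and fibre: "card A \<le> card (f -` {b} \<inter> A) * card B"
    using pigeonhole_card[OF assms(1-3)] by blast
  have "m * card B < card (f -` {b} \<inter> A) * card B"
    using assms(4) fibre by (simp only: mult.commute[of m])
  then have "card {..<m} \<le> card (f -` {b} \<inter> A)" by simp
  then obtain h where "h ` {..<m} \<subseteq> f -` {b} \<inter> A" "inj_on h {..<m}"
    using card_le_inj[of "{..<m}" "f -` {b} \<inter> A"] assms(2) by auto
  with \<open>b \<in> B\<close> show thesis using that by blast
qed

lemma ex_orientation_copies_free:
  assumes "pair_graph G" "admits_free_orientation F (copies (card {A. orientation_of A G} * m + 1) G)"
  shows "\<exists>A. orientation_of A G \<and> free_of F (copies m A)"
proof -
  define M where "M = card {A. orientation_of A G} * m + 1"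
  obtain D where orients: "orientation_of D (copies M G)" and free: "free_of F D"
    using assms(2) unfolding admits_free_orientation_def M_def by blast
  define orient where "orient j = pullback (Pair j) (pverts G) D" for j :: nat
  have "orient \<in> {..<M} \<rightarrow> {A. orientation_of A G}"
    using orientation_of_pullback[OF induced_embedding_Pair _ orients] assms(1)
    by (auto simp: orient_def pair_graph_imp_pair_wf_digraph)
  then obtain A h where A_orients: "orientation_of A G"
    and h_inj: "inj_on h {..<m}" and h_range: "h ` {..<m} \<subseteq> orient -` {A} \<inter> {..<M}"
    using finite_orientations[OF assms(1)]
    by (elim pigeonhole_card_inj[where m = m]) (auto simp: M_def)
  have "D = disjoint_union {..<M} orient"
    unfolding orient_def by (rule orientation_of_disjoint_union_eq[OF orients])
  then have "has_induced_copy D (disjoint_union {..<m} (orient \<circ> h))"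
    using has_induced_copy_reindex_disjoint_union[of "{..<M}" orient h "{..<m}"] h_inj h_range orients
    by (auto simp: orientation_of_iff oriented_graph_imp_pair_wf_digraph)
  moreover have "disjoint_union {..<m} (orient \<circ> h) = copies m A"
    using h_range by (intro disjoint_union_cong) auto
  ultimately show ?thesis
    using A_orients free free_of_induced_copy by auto
qed

lemma ex_orientation_all_copies_free:
  assumes "pair_graph G" "\<And>m. admits_free_orientation F (copies m G)"
  shows "\<exists>A. orientation_of A G \<and> (\<forall>m. free_of F (copies m A))"
proof -
  obtain A where orients: "\<And>m. orientation_of (A m) G" and free: "\<And>m. free_of F (copies m (A m))"
    using ex_orientation_copies_free[OF assms(1)] assms(2) by metis
  have "finite (range A)"
    using finite_subset[OF _ finite_orientations[OF assms(1)]] orients by blast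
  then obtain k where recurs: "infinite {m. A m = A k}"
    using pigeonhole_infinite[of UNIV A] by auto
  have "free_of F (copies m (A k))" for m
  proof -
    obtain m' where "m \<le> m'" "A m' = A k"
      using recurs by (auto simp: infinite_nat_iff_unbounded_le)
    moreover have "has_induced_copy (copies m' (A k)) (copies m (A k))"
      using has_induced_copy_reindex_disjoint_union[of "{..<m'}" "\<lambda>_. A k" id "{..<m}"] \<open>m \<le> m'\<close> orients
      by (auto simp: pair_wf_digraph_disjoint_union_iff orientation_of_iff
          oriented_graph_imp_pair_wf_digraph comp_def)
    ultimately show ?thesis using free[of m'] free_of_induced_copy by metis
  qed
  then show ?thesis using orients by blast
qed

section \<open>Paths and cycles\<close>

definition path_graph :: "nat \<Rightarrow> nat pair_pre_digraph" where
  "path_graph n = \<lparr>pverts = {..<n}, parcs = {(i, j). i < n \<and> j < n \<and> (j = Suc i \<or> i = Suc j)}\<rparr>"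

lemma pverts_path_graph [simp]: "pverts (path_graph n) = {..<n}"
  by (simp add: path_graph_def)

lemma in_parcs_path_graph_iff [simp]:
  "(i, j) \<in> parcs (path_graph n) \<longleftrightarrow> i < n \<and> j < n \<and> (j = Suc i \<or> i = Suc j)"
  by (simp add: path_graph_def)

lemma pair_graph_path_graph: "pair_graph (path_graph n)"
  by (auto simp: pair_graph_iff irrefl_def sym_def)

lemma induced_embedding_path_graphI:
  assumes "pair_graph G" "\<And>s. s < N \<Longrightarrow> f s \<in> pverts G"
    and sep: "\<And>s s'. s < s' \<Longrightarrow> s' < N \<Longrightarrow> f s \<noteq> f s' \<and> ((f s, f s') \<in> parcs G \<longleftrightarrow> s' = Suc s)"
  shows "induced_embedding f (path_graph N) G"
proof (rule induced_embeddingI)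
  show "inj_on f (pverts (path_graph N))"
    by (rule linorder_inj_onI') (use sep in auto)
  have sym: "sym (parcs G)" and irrefl: "irrefl (parcs G)"
    using assms(1) by (simp_all add: pair_graph_iff)
  show "(s, s') \<in> parcs (path_graph N) \<longleftrightarrow> (f s, f s') \<in> parcs G"
    if "s \<in> pverts (path_graph N)" "s' \<in> pverts (path_graph N)" for s s'
  proof (cases s s' rule: linorder_cases)
    case less
    then show ?thesis using sep[of s s'] that by auto
  next
    case equal
    then show ?thesis using irrefl by (simp add: irrefl_def)
  next
    case greater
    have "(f s, f s') \<in> parcs G \<longleftrightarrow> (f s', f s) \<in> parcs G"
      using sym by (auto dest: symD)
    then show ?thesis using sep[of s' s] that greater by auto
  qed
qed (use assms(2) in simp)

lemma pverts_cycle_graph [simp]: "pverts (cycle_graph k) = {..<k}"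
  by (simp add: cycle_graph_def)

lemma in_parcs_cycle_graph_iff [simp]:
  "(i, j) \<in> parcs (cycle_graph k) \<longleftrightarrow> i < k \<and> j < k \<and> (j = Suc i mod k \<or> i = Suc j mod k)"
  by (simp add: cycle_graph_def)

lemma pair_wf_digraph_cycle_graph: "pair_wf_digraph (cycle_graph k)"
  by (auto simp: pair_wf_digraph_iff)

lemma pair_graph_cycle_graph: "2 \<le> k \<Longrightarrow> pair_graph (cycle_graph k)"
  by (auto simp: pair_graph_iff irrefl_def sym_def mod_Suc split: if_splits)

definition oriented_path :: "(nat \<Rightarrow> bool) \<Rightarrow> nat \<Rightarrow> nat pair_pre_digraph" where
  "oriented_path w n =
     \<lparr>pverts = {..<n}, parcs = {(i, j). i < n \<and> j < n \<and> (j = Suc i \<and> w i \<or> i = Suc j \<and> \<not> w j)}\<rparr>"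

definition oriented_cycle :: "(nat \<Rightarrow> bool) \<Rightarrow> nat \<Rightarrow> nat pair_pre_digraph" where
  "oriented_cycle w q =
     \<lparr>pverts = {..<q},
      parcs = {(i, j). i < q \<and> j < q \<and> (j = Suc i mod q \<and> w i \<or> i = Suc j mod q \<and> \<not> w j)}\<rparr>"

lemma pverts_oriented_path [simp]: "pverts (oriented_path w n) = {..<n}"
  by (simp add: oriented_path_def)

lemma in_parcs_oriented_path_iff [simp]:
  "(i, j) \<in> parcs (oriented_path w n) \<longleftrightarrow>
     i < n \<and> j < n \<and> (j = Suc i \<and> w i \<or> i = Suc j \<and> \<not> w j)"
  by (simp add: oriented_path_def)

lemma pverts_oriented_cycle [simp]: "pverts (oriented_cycle w q) = {..<q}"
  by (simp add: oriented_cycle_def)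

lemma in_parcs_oriented_cycle_iff [simp]:
  "(i, j) \<in> parcs (oriented_cycle w q) \<longleftrightarrow>
     i < q \<and> j < q \<and> (j = Suc i mod q \<and> w i \<or> i = Suc j mod q \<and> \<not> w j)"
  by (simp add: oriented_cycle_def)

lemma pair_wf_digraph_oriented_path: "pair_wf_digraph (oriented_path w n)"
  by (auto simp: pair_wf_digraph_iff)

lemma oriented_path_cong:
  "(\<And>i. Suc i < n \<Longrightarrow> w i = w' i) \<Longrightarrow> oriented_path w n = oriented_path w' n"
  by (auto simp: oriented_path_def)

lemma has_induced_copy_oriented_path_shift:
  assumes "a + m \<le> n"
  shows "has_induced_copy (oriented_path w n) (oriented_path (\<lambda>i. w (a + i)) m)"
proof -
  have "induced_embedding ((+) a) (oriented_path (\<lambda>i. w (a + i)) m) (oriented_path w n)"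
    using assms by (intro induced_embeddingI) auto
  then show ?thesis
    by (auto simp: has_induced_copy_iff pair_wf_digraph_oriented_path)
qed

lemma orientation_of_path_graph_eq:
  assumes "orientation_of D (path_graph n)"
  shows "D = oriented_path (\<lambda>i. (i, Suc i) \<in> parcs D) n"
proof (rule pair_pre_digraph.equality)
  show "pverts D = pverts (oriented_path (\<lambda>i. (i, Suc i) \<in> parcs D) n)"
    using assms by (simp add: orientation_of_iff)
  have asym: "asym (parcs D)" and arcs: "parcs (path_graph n) = parcs D \<union> (parcs D)\<inverse>"
    using assms by (simp_all add: orientation_of_iff oriented_graph_iff)
  have "(i, j) \<in> parcs D \<longleftrightarrow> (i, j) \<in> parcs (oriented_path (\<lambda>i. (i, Suc i) \<in> parcs D) n)" for i j
  proof -
    have "(i, j) \<in> parcs (path_graph n) \<longleftrightarrow> (i, j) \<in> parcs D \<or> (j, i) \<in> parcs D"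
      using arcs by auto
    then show ?thesis
      using asymD[OF asym, of i j] asymD[OF asym, of j i] by auto
  qed
  then show "parcs D = parcs (oriented_path (\<lambda>i. (i, Suc i) \<in> parcs D) n)"
    unfolding set_eq_iff split_paired_All by blast
qed simp

lemma orientation_of_oriented_cycle:
  assumes "3 \<le> q"
  shows "orientation_of (oriented_cycle w q) (cycle_graph q)"
proof -
  have "\<not> (j = Suc i mod q \<and> i = Suc j mod q)" if "i < q" "j < q" for i j
    using assms that by (auto simp: mod_Suc)
  then have "asym (parcs (oriented_cycle w q))"
    by (intro asymI) auto
  then have "oriented_graph (oriented_cycle w q)"
    by (auto simp: oriented_graph_iff)
  then show ?thesis
    by (auto simp: orientation_of_iff)
qed

section \<open>Windows of oriented cycles\<close>

lemma inj_on_add_mod: "inj_on (\<lambda>j. (p + j) mod q) {..<q}" for p q :: nat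
proof (rule inj_onI)
  fix i j assume "i \<in> {..<q}" "j \<in> {..<q}" "(p + i) mod q = (p + j) mod q"
  then show "i = j"
  proof (induction i j rule: linorder_wlog)
    case (le i j)
    then have "q dvd j - i"
      using mod_eq_dvd_iff_nat[of "p + i" "p + j" q] by simp
    moreover have "j - i < q" using le by simp
    ultimately show ?case using le by (auto dest: dvd_imp_le)
  qed simp
qed

definition windows :: "(nat \<Rightarrow> bool) \<Rightarrow> nat \<Rightarrow> nat \<Rightarrow> (nat \<times> nat) pair_pre_digraph" where
  "windows w q N = disjoint_union {..<q} (\<lambda>r. oriented_path (\<lambda>s. w ((r + s) mod q)) N)"

lemma pverts_windows [simp]: "pverts (windows w q N) = {..<q} \<times> {..<N}"
  by (simp add: windows_def)

lemma in_parcs_windows_iff [simp]: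
  "((r, s), (r', s')) \<in> parcs (windows w q N) \<longleftrightarrow> r < q \<and> r = r' \<and> s < N \<and> s' < N \<and>
     (s' = Suc s \<and> w ((r + s) mod q) \<or> s = Suc s' \<and> \<not> w ((r + s') mod q))"
  by (auto simp: windows_def)

lemma pair_wf_digraph_windows: "pair_wf_digraph (windows w q N)"
  by (simp add: windows_def pair_wf_digraph_disjoint_union_iff pair_wf_digraph_oriented_path)

context
  fixes q N :: nat and S :: "nat set"
  assumes S_subset: "S \<subseteq> {..<q}" and S_card: "card S \<le> N" and N_less: "N < q"
begin

definition run_length :: "nat \<Rightarrow> nat" where
  "run_length p = (LEAST j. (p + j) mod q \<notin> S)"

text \<open>The run of \<open>S\<close> through \<open>p\<close> is moved as a whole to the window ending right before the first
  vertex \<open>p + run_length p\<close> behind the run; different runs thus go to different windows.\<close>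

definition run_position :: "nat \<Rightarrow> nat \<times> nat" where
  "run_position p = ((p + run_length p + (q - N)) mod q, N - run_length p)"

lemma ex_run_end: "\<exists>j\<le>N. (p + j) mod q \<notin> S"
proof (rule ccontr)
  assume "\<not> (\<exists>j\<le>N. (p + j) mod q \<notin> S)"
  then have "(\<lambda>j. (p + j) mod q) ` {..N} \<subseteq> S" by auto
  moreover have "inj_on (\<lambda>j. (p + j) mod q) {..N}"
    using N_less by (intro inj_on_subset[OF inj_on_add_mod]) auto
  ultimately have "card {..N} \<le> card S"
    using S_subset by (intro card_inj_on_le) (auto intro: finite_subset)
  then show False using S_card by simp
qed

lemma run_length_le: "run_length p \<le> N"
proof -
  obtain j where "j \<le> N" "(p + j) mod q \<notin> S"
    using ex_run_end by blast
  then show ?thesis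
    unfolding run_length_def by (blast intro: Least_le le_trans)
qed

lemma run_length_Suc_mod:
  assumes "p \<in> S"
  shows "run_length p = Suc (run_length (Suc p mod q))"
proof -
  obtain j where "(p + j) mod q \<notin> S"
    using ex_run_end by blast
  moreover have "p mod q = p" using assms S_subset by auto
  ultimately have "run_length p = Suc (LEAST j. (p + Suc j) mod q \<notin> S)"
    unfolding run_length_def by (intro Least_Suc) (use assms in simp_all)
  moreover have "(p + Suc j) mod q = (Suc p mod q + j) mod q" for j
    by (simp add: mod_add_left_eq)
  ultimately show ?thesis by (simp only: run_length_def)
qed

lemma run_position_bounds:
  assumes "p \<in> S"
  shows "fst (run_position p) < q" "snd (run_position p) < N"
  using run_length_Suc_mod[OF assms] run_length_le[of p] N_less by (auto simp: run_position_def)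

lemma run_position_sum_mod:
  assumes "p \<in> S"
  shows "(fst (run_position p) + snd (run_position p)) mod q = p"
proof -
  have "(fst (run_position p) + snd (run_position p)) mod q =
      (p + run_length p + (q - N) + (N - run_length p)) mod q"
    unfolding run_position_def fst_conv snd_conv by (rule mod_add_left_eq)
  also have "p + run_length p + (q - N) + (N - run_length p) = p + q"
    using run_length_le[of p] N_less by simp
  finally show ?thesis using assms S_subset by auto
qed

lemma run_position_Suc_mod:
  assumes "p \<in> S" "Suc p mod q \<in> S"
  shows "run_position (Suc p mod q) = (fst (run_position p), Suc (snd (run_position p)))"
proof -
  let ?l = "run_length (Suc p mod q)"
  have "run_length p = Suc ?l" by (rule run_length_Suc_mod[OF assms(1)])
  moreover have "(Suc p mod q + (?l + (q - N))) mod q = (Suc p + (?l + (q - N))) mod q"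
    by (rule mod_add_left_eq)
  moreover have "Suc ?l \<le> N"
    using run_length_le[of p] calculation(1) by simp
  ultimately show ?thesis
    by (simp add: run_position_def add.assoc Suc_diff_Suc)
qed

lemma run_position_succ_iff:
  assumes "p \<in> S" "p' \<in> S"
  shows "p' = Suc p mod q \<longleftrightarrow>
    fst (run_position p') = fst (run_position p) \<and> snd (run_position p') = Suc (snd (run_position p))"
proof
  assume "p' = Suc p mod q"
  then show "fst (run_position p') = fst (run_position p) \<and>
      snd (run_position p') = Suc (snd (run_position p))"
    using run_position_Suc_mod assms by simp
next
  assume "fst (run_position p') = fst (run_position p) \<and>
    snd (run_position p') = Suc (snd (run_position p))"
  then have "p' = Suc (fst (run_position p) + snd (run_position p)) mod q"
    using run_position_sum_mod[OF assms(2)] by simp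
  also have "\<dots> = Suc ((fst (run_position p) + snd (run_position p)) mod q) mod q"
    by (rule mod_Suc_eq[symmetric])
  finally show "p' = Suc p mod q"
    by (simp only: run_position_sum_mod[OF assms(1)])
qed

lemma induced_embedding_run_position:
  "induced_embedding run_position (pullback id S (oriented_cycle w q)) (windows w q N)"
proof (rule induced_embeddingI)
  show "inj_on run_position (pverts (pullback id S (oriented_cycle w q)))"
    using run_position_sum_mod by (metis inj_onI pverts_pullback)
  show "run_position p \<in> pverts (windows w q N)"
    if "p \<in> pverts (pullback id S (oriented_cycle w q))" for p
    using that run_position_bounds by (simp add: mem_Times_iff)
  fix p p'
  assume "p \<in> pverts (pullback id S (oriented_cycle w q))"
    "p' \<in> pverts (pullback id S (oriented_cycle w q))"
  then have p_in_S: "p \<in> S" "p' \<in> S" by simp_all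
  obtain r s r' s' where position: "run_position p = (r, s)" "run_position p' = (r', s')"
    by (meson surj_pair)
  have "(p, p') \<in> parcs (pullback id S (oriented_cycle w q)) \<longleftrightarrow>
      p' = Suc p mod q \<and> w p \<or> p = Suc p' mod q \<and> \<not> w p'"
    using p_in_S S_subset by auto
  also have "\<dots> \<longleftrightarrow> r = r' \<and> (s' = Suc s \<and> w p \<or> s = Suc s' \<and> \<not> w p')"
    using run_position_succ_iff[OF p_in_S] run_position_succ_iff[OF p_in_S(2,1)]
    by (auto simp: position)
  also have "\<dots> \<longleftrightarrow> (run_position p, run_position p') \<in> parcs (windows w q N)"
    using run_position_bounds[OF p_in_S(1)] run_position_bounds[OF p_in_S(2)]
      run_position_sum_mod[OF p_in_S(1)] run_position_sum_mod[OF p_in_S(2)]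
    by (auto simp: position)
  finally show "(p, p') \<in> parcs (pullback id S (oriented_cycle w q)) \<longleftrightarrow>
      (run_position p, run_position p') \<in> parcs (windows w q N)" .
qed

end

lemma has_induced_copy_windows:
  assumes "has_induced_copy (oriented_cycle w q) H" "card (pverts H) \<le> N" "N < q"
  shows "has_induced_copy (windows w q N) H"
proof -
  obtain f where emb: "induced_embedding f H (oriented_cycle w q)" and wf: "pair_wf_digraph H"
    using assms(1) by (auto simp: has_induced_copy_iff)
  let ?S = "f ` pverts H"
  have S_subset: "?S \<subseteq> {..<q}" using emb by (simp add: induced_embedding_def)
  have S_card: "card ?S \<le> N"
    using assms(2) card_image[OF induced_embeddingD(1)[OF emb]] by simp
  have "induced_embedding f H (pullback id ?S (oriented_cycle w q))"
    using induced_embeddingD[OF emb] by (intro induced_embeddingI) simp_all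
  from induced_embedding_comp[OF this induced_embedding_run_position[OF S_subset S_card assms(3)]]
  show ?thesis
    using wf pair_wf_digraph_windows by (auto simp: has_induced_copy_iff)
qed

lemma free_of_oriented_cycle:
  assumes "\<forall>H\<in>F. card (pverts H) \<le> N" "N < q"
    and free: "\<And>m. free_of F (copies m A)"
    and window: "\<And>r. r < q \<Longrightarrow> has_induced_copy A (oriented_path (\<lambda>s. w ((r + s) mod q)) N)"
  shows "free_of F (oriented_cycle w q)"
  unfolding free_of_def
proof (intro ballI notI)
  fix H assume "H \<in> F" "has_induced_copy (oriented_cycle w q) H"
  then have "has_induced_copy (windows w q N) H"
    using assms(1,2) by (intro has_induced_copy_windows) simp_all
  moreover have "has_induced_copy (copies q A) (windows w q N)"
    unfolding windows_def using window by (intro has_induced_copy_disjoint_union) simp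
  ultimately have "has_induced_copy (copies q A) H"
    using has_induced_copy_trans by blast
  then show False using free \<open>H \<in> F\<close> by (auto simp: free_of_def)
qed

lemma admits_free_orientation_cycle_graph:
  assumes "\<forall>H\<in>F. card (pverts H) \<le> N" "N < q" "3 \<le> q"
    and graph_copies: "pair_graph G" "\<And>m. admits_free_orientation F (copies m G)"
    and walk: "\<And>r. r < q \<Longrightarrow> induced_embedding (\<lambda>s. \<phi> ((r + s) mod q)) (path_graph N) G"
  shows "admits_free_orientation F (cycle_graph q)"
proof -
  obtain A where orients: "orientation_of A G" and free: "\<And>m. free_of F (copies m A)"
    using ex_orientation_all_copies_free[OF graph_copies] by blast
  define w where "w i \<longleftrightarrow> (\<phi> i, \<phi> (Suc i mod q)) \<in> parcs A" for i
  have "has_induced_copy A (oriented_path (\<lambda>s. w ((r + s) mod q)) N)" if "r < q" for r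
  proof -
    let ?D = "pullback (\<lambda>s. \<phi> ((r + s) mod q)) {..<N} A"
    have "orientation_of ?D (path_graph N)"
      using orientation_of_pullback[OF walk[OF that] _ orients]
        pair_graph_imp_pair_wf_digraph[OF pair_graph_path_graph] by simp
    then have "?D = oriented_path (\<lambda>s. (s, Suc s) \<in> parcs ?D) N"
      by (rule orientation_of_path_graph_eq)
    also have "\<dots> = oriented_path (\<lambda>s. w ((r + s) mod q)) N"
      by (rule oriented_path_cong) (simp add: w_def mod_Suc_eq)
    finally show ?thesis
      using has_induced_copy_orientation_pullback[OF walk[OF that] orients] by simp
  qed
  then have "free_of F (oriented_cycle w q)"
    using free_of_oriented_cycle[OF assms(1,2) free] by simp
  then show ?thesis
    using orientation_of_oriented_cycle[OF assms(3)] by (auto simp: admits_free_orientation_def)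
qed

lemma repeated_factor:
  fixes w :: "nat \<Rightarrow> 'a::finite" and K N :: nat
  assumes "0 < K"
  obtains a q where "K \<le> q" "a + q \<le> K * CARD('a) ^ N" "\<And>t. t < N \<Longrightarrow> w (a + q + t) = w (a + t)"
proof -
  define W where "W i = map (\<lambda>t. w (i * K + t)) [0..<N]" for i
  let ?words = "{xs :: 'a list. set xs \<subseteq> UNIV \<and> length xs = N}"
  have "card (W ` {..CARD('a) ^ N}) \<le> card ?words"
    by (intro card_mono finite_lists_length_eq) (auto simp: W_def)
  also have "\<dots> < card {..CARD('a) ^ N}"
    by (subst card_lists_length_eq) auto
  finally have "\<not> inj_on W {..CARD('a) ^ N}" by (rule pigeonhole)
  then obtain i j where "i < j" and j_le: "j \<le> CARD('a) ^ N" and W_eq: "W i = W j"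
    unfolding inj_on_def by (metis atMost_iff linorder_neqE_nat)
  have block_sum: "i * K + (j - i) * K = j * K"
    using \<open>i < j\<close> by (simp flip: add_mult_distrib)
  show thesis
  proof (rule that[of "(j - i) * K" "i * K"])
    show "K \<le> (j - i) * K" using \<open>i < j\<close> by (simp add: Suc_le_eq)
    show "i * K + (j - i) * K \<le> K * CARD('a) ^ N"
      unfolding block_sum using j_le by (simp add: mult.commute)
    show "w (i * K + (j - i) * K + t) = w (i * K + t)" if "t < N" for t
      using arg_cong[OF W_eq, of "\<lambda>xs. xs ! t"] that by (simp add: block_sum W_def)
  qed
qed

lemma repeated_factor_mod:
  fixes w :: "nat \<Rightarrow> 'a"
  assumes period: "\<And>t. t < N \<Longrightarrow> w (a + q + t) = w (a + t)" and "N \<le> q" "r < q" "s < N"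
  shows "w (a + (r + s) mod q) = w (a + (r + s))"
proof (cases "r + s < q")
  case False
  then obtain t where wrap: "r + s = q + t" using le_Suc_ex not_less by blast
  then have "t < N" "(r + s) mod q = t" using assms(2-4) by simp_all
  then show ?thesis using period[of t] wrap by (simp add: add.assoc)
qed simp

lemma admits_free_orientation_long_cycle_graph:
  assumes "\<forall>H\<in>F. card (pverts H) \<le> N"
    and paths: "\<And>n m. admits_free_orientation F (copies m (path_graph n))"
  shows "\<exists>q>N. 3 \<le> q \<and> admits_free_orientation F (cycle_graph q)"
proof -
  define n where "n = (N + 3) * CARD(bool) ^ N + N"
  obtain A where "orientation_of A (path_graph n)" and free: "\<And>m. free_of F (copies m A)"
    using ex_orientation_all_copies_free[OF pair_graph_path_graph paths] by blast
  then obtain w where A_eq: "A = oriented_path w n"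
    using orientation_of_path_graph_eq by blast
  obtain a q where q_ge: "N + 3 \<le> q" and "a + q \<le> (N + 3) * CARD(bool) ^ N"
    and period: "\<And>t. t < N \<Longrightarrow> w (a + q + t) = w (a + t)"
    by (rule repeated_factor[of "N + 3" N w]) auto
  then have fits: "a + q + N \<le> n" by (simp add: n_def)
  have "has_induced_copy A (oriented_path (\<lambda>s. w (a + (r + s) mod q)) N)" if "r < q" for r
  proof -
    have "oriented_path (\<lambda>s. w (a + (r + s) mod q)) N = oriented_path (\<lambda>s. w (a + r + s)) N"
      using repeated_factor_mod[of N w, OF period] q_ge that
      by (intro oriented_path_cong) (simp add: add.assoc)
    then show ?thesis
      using has_induced_copy_oriented_path_shift[of "a + r" N n w] that fits by (simp add: A_eq)
  qed
  then have "free_of F (oriented_cycle (\<lambda>i. w (a + i)) q)"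
    using q_ge free by (intro free_of_oriented_cycle[OF assms(1)]) simp_all
  moreover have "orientation_of (oriented_cycle (\<lambda>i. w (a + i)) q) (cycle_graph q)"
    using q_ge by (intro orientation_of_oriented_cycle) simp
  ultimately have "admits_free_orientation F (cycle_graph q)"
    by (auto simp: admits_free_orientation_def)
  then show ?thesis using q_ge by (intro exI[of _ q]) simp
qed

section \<open>Induced cycles\<close>

definition induced_cycle :: "'a pair_pre_digraph \<Rightarrow> 'a set \<Rightarrow> bool" where
  "induced_cycle G S \<longleftrightarrow> (\<exists>c\<ge>3. \<exists>f. induced_embedding f (cycle_graph c) G \<and> S = f ` {..<c})"

lemma induced_cycleE:
  assumes "induced_cycle G S"
  obtains c f where "3 \<le> c" "inj_on f {..<c}" "S = f ` {..<c}"
    "\<And>i j. i < c \<Longrightarrow> j < c \<Longrightarrow> (f i, f j) \<in> parcs G \<longleftrightarrow> (i, j) \<in> parcs (cycle_graph c)"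
proof -
  obtain c f where "3 \<le> c" "induced_embedding f (cycle_graph c) G" "S = f ` {..<c}"
    using assms by (auto simp: induced_cycle_def)
  then show thesis
    using that[of c f] induced_embeddingD(1,3)[of f "cycle_graph c" G] by simp
qed

lemma induced_cycle_finite: "induced_cycle G S \<Longrightarrow> finite S"
  by (auto simp: induced_cycle_def)

lemma induced_cycle_nonempty: "induced_cycle G S \<Longrightarrow> S \<noteq> {}"
  by (auto simp: induced_cycle_def lessThan_empty_iff)

lemma induced_embedding_imp_induced_cycle:
  assumes "induced_embedding f (cycle_graph c) G" "3 \<le> c"
  shows "induced_cycle G (f ` {..<c})" "card (f ` {..<c}) = c" "f ` {..<c} \<subseteq> pverts G"
  using assms card_image[of f "{..<c}"] by (auto simp: induced_cycle_def induced_embedding_def)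

lemma card_neighbours_cycle_graph:
  assumes "3 \<le> c" "i < c"
  shows "card {j. (i, j) \<in> parcs (cycle_graph c)} = 2"
proof -
  define p where "p = (if i = 0 then c - 1 else i - 1)"
  have "p < c" "p \<noteq> Suc i mod c"
    using assms by (auto simp: p_def mod_Suc)
  moreover have "i = Suc j mod c \<longleftrightarrow> j = p" if "j < c" for j
    using assms that by (auto simp: p_def mod_Suc)
  ultimately have "{j. (i, j) \<in> parcs (cycle_graph c)} = {Suc i mod c, p}"
    using assms by auto
  then show ?thesis using \<open>p \<noteq> Suc i mod c\<close> by simp
qed

lemma card_neighbours_induced_cycle:
  assumes "induced_cycle G S" "x \<in> S"
  shows "card {y \<in> S. (x, y) \<in> parcs G} = 2"
proof -
  obtain c f where c_ge: "3 \<le> c" and inj: "inj_on f {..<c}" and S_eq: "S = f ` {..<c}"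
    and arcs: "\<And>i j. i < c \<Longrightarrow> j < c \<Longrightarrow>
      (f i, f j) \<in> parcs G \<longleftrightarrow> (i, j) \<in> parcs (cycle_graph c)"
    by (rule induced_cycleE[OF assms(1)]) blast
  obtain i where "i < c" and x_eq: "x = f i" using assms(2) S_eq by auto
  have "{y \<in> S. (x, y) \<in> parcs G} = f ` {j. (i, j) \<in> parcs (cycle_graph c)}"
    unfolding S_eq x_eq using arcs[OF \<open>i < c\<close>] \<open>i < c\<close> by auto
  moreover have "inj_on f {j. (i, j) \<in> parcs (cycle_graph c)}"
    by (rule inj_on_subset[OF inj]) auto
  ultimately show ?thesis
    using card_neighbours_cycle_graph[OF c_ge \<open>i < c\<close>] by (simp add: card_image)
qed

lemma induced_cycle_neighbours:
  assumes "induced_cycle G S" "x \<in> S"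
    and "\<And>z. z \<in> S \<Longrightarrow> (x, z) \<in> parcs G \<Longrightarrow> z = y \<or> z = y'"
  shows "y \<in> S" "y' \<in> S" "y \<noteq> y'"
proof -
  let ?A = "{z \<in> S. (x, z) \<in> parcs G}"
  have "?A \<subseteq> {y, y'}" using assms(3) by auto
  moreover have "card {y, y'} \<le> card ?A"
    using card_neighbours_induced_cycle[OF assms(1,2)] by (simp add: card_insert_if)
  ultimately have neighbours_eq: "?A = {y, y'}" by (intro card_seteq) auto
  then show "y \<in> S" "y' \<in> S" by auto
  show "y \<noteq> y'"
    using card_neighbours_induced_cycle[OF assms(1,2)] neighbours_eq by auto
qed

lemma induced_cycle_connected:
  assumes "induced_cycle G S" "x \<in> S" "x \<in> T"
    and closed: "\<And>u v. \<lbrakk>u \<in> S; u \<in> T; v \<in> S; (u, v) \<in> parcs G\<rbrakk> \<Longrightarrow> v \<in> T"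
  shows "S \<subseteq> T"
proof -
  obtain c f where S_eq: "S = f ` {..<c}"
    and arcs: "\<And>i j. i < c \<Longrightarrow> j < c \<Longrightarrow>
      (f i, f j) \<in> parcs G \<longleftrightarrow> (i, j) \<in> parcs (cycle_graph c)"
    by (rule induced_cycleE[OF assms(1)]) blast
  obtain i where "i < c" and x_eq: "x = f i" using assms(2) S_eq by auto
  have reach: "f ((i + j) mod c) \<in> T" for j
  proof (induction j)
    case (Suc j)
    have "(i + j) mod c < c" "Suc (i + j) mod c < c" using \<open>i < c\<close> by auto
    moreover from this have "(f ((i + j) mod c), f (Suc (i + j) mod c)) \<in> parcs G"
      using arcs by (simp add: mod_Suc_eq)
    ultimately show ?case using closed[OF _ Suc] S_eq by simp
  qed (use assms(3) x_eq \<open>i < c\<close> in simp)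
  have "f j \<in> T" if "j < c" for j
  proof -
    have "(i + (j + c - i)) mod c = j" using \<open>i < c\<close> that by simp
    then show ?thesis using reach[of "j + c - i"] by simp
  qed
  then show ?thesis using S_eq by auto
qed

lemma induced_cycle_subset_eq:
  assumes S_cycle: "induced_cycle G S" and T_cycle: "induced_cycle G T" and "T \<subseteq> S"
  shows "T = S"
proof
  have "v \<in> T" if "u \<in> T" "v \<in> S" "(u, v) \<in> parcs G" for u v
  proof -
    have "{y \<in> T. (u, y) \<in> parcs G} = {y \<in> S. (u, y) \<in> parcs G}"
    proof (rule card_subset_eq)
      show "card {y \<in> T. (u, y) \<in> parcs G} = card {y \<in> S. (u, y) \<in> parcs G}"
        using card_neighbours_induced_cycle[OF S_cycle, of u]
          card_neighbours_induced_cycle[OF T_cycle, of u] \<open>u \<in> T\<close> \<open>T \<subseteq> S\<close>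
        by auto
    qed (use \<open>T \<subseteq> S\<close> induced_cycle_finite[OF S_cycle] in auto)
    then show ?thesis using that by blast
  qed
  moreover obtain x where "x \<in> T" using induced_cycle_nonempty[OF T_cycle] by blast
  ultimately show "S \<subseteq> T"
    using induced_cycle_connected[OF S_cycle, of x T] \<open>T \<subseteq> S\<close> by blast
qed fact

lemma has_hole_imp_induced_cycle:
  assumes "has_hole G c"
  obtains S where "induced_cycle G S" "card S = c" "S \<subseteq> pverts G"
proof -
  obtain f where "induced_embedding f (cycle_graph c) G" "3 \<le> c"
    using assms by (auto simp: has_hole_def has_induced_copy_iff)
  from induced_embedding_imp_induced_cycle[OF this] show thesis by (rule that)
qed

lemma has_hole_cycle_graph_iff: "has_hole (cycle_graph k) c \<longleftrightarrow> c = k \<and> 4 \<le> k"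
proof
  assume hole: "has_hole (cycle_graph k) c"
  then obtain S where cycle: "induced_cycle (cycle_graph k) S"
    and card: "card S = c" and sub: "S \<subseteq> {..<k}"
    by (metis has_hole_imp_induced_cycle pverts_cycle_graph)
  have "4 \<le> c" using hole by (simp add: has_hole_def)
  moreover have "c \<le> k" using card card_mono[OF finite_lessThan sub] by simp
  ultimately have "induced_cycle (cycle_graph k) {..<k}"
    using induced_embedding_imp_induced_cycle(1)[OF induced_embedding_id, of k] by simp
  then have "S = {..<k}"
    by (rule induced_cycle_subset_eq[OF _ cycle sub])
  then show "c = k \<and> 4 \<le> k" using card \<open>4 \<le> c\<close> by simp
next
  assume "c = k \<and> 4 \<le> k"
  then show "has_hole (cycle_graph k) c"
    using pair_wf_digraph_cycle_graph induced_embedding_id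
    by (auto simp: has_hole_def has_induced_copy_iff)
qed

lemma has_hole_disjoint_union:
  assumes "has_hole (disjoint_union I D) c"
  shows "\<exists>i\<in>I. has_hole (D i) c"
proof -
  obtain f where emb: "induced_embedding f (cycle_graph c) (disjoint_union I D)" and "4 \<le> c"
    and wf: "pair_wf_digraph (disjoint_union I D)"
    using assms by (auto simp: has_hole_def has_induced_copy_iff)
  have same_component: "fst p = fst p'" if "(p, p') \<in> parcs (disjoint_union I D)" for p p'
    using that by (auto simp: disjoint_union_def)
  have "f ` {..<c} \<subseteq> {p. fst p = fst (f 0)}"
    by (rule induced_cycle_connected[OF induced_embedding_imp_induced_cycle(1)[OF emb], of "f 0"])
      (use \<open>4 \<le> c\<close> same_component in auto)
  moreover have "fst (f 0) \<in> I"
    using induced_embeddingD(2)[OF emb, of 0] \<open>4 \<le> c\<close> by (auto simp: mem_Times_iff)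
  ultimately have "induced_embedding (snd \<circ> f) (cycle_graph c) (D (fst (f 0)))"
    by (intro induced_embedding_snd[OF emb]) auto
  then have "has_hole (D (fst (f 0))) c"
    using \<open>fst (f 0) \<in> I\<close> \<open>4 \<le> c\<close> wf
    by (auto simp: has_hole_def has_induced_copy_iff pair_wf_digraph_disjoint_union_iff
        pair_wf_digraph_cycle_graph)
  then show ?thesis using \<open>fst (f 0) \<in> I\<close> by blast
qed

lemma not_has_hole_path_graph: "\<not> has_hole (path_graph n) c"
proof
  assume "has_hole (path_graph n) c"
  then obtain S where cycle: "induced_cycle (path_graph n) S"
    by (rule has_hole_imp_induced_cycle)
  have "Min S \<in> S" using induced_cycle_finite[OF cycle] induced_cycle_nonempty[OF cycle] by simp
  moreover have "z = Suc (Min S)" if "z \<in> S" "(Min S, z) \<in> parcs (path_graph n)" for z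
    using that Min_le[OF induced_cycle_finite[OF cycle] that(1)] by auto
  ultimately show False using induced_cycle_neighbours(3)[OF cycle] by blast
qed

section \<open>Dumbbells\<close>

text \<open>Two cycles, of lengths \<open>k\<close> and \<open>k'\<close>, joined by a path, encoded as the path
  \<open>0, \<dots>, k + k' + l - 1\<close> with a chord at each end.\<close>

definition dumbbell_arc :: "nat \<Rightarrow> nat \<Rightarrow> nat \<Rightarrow> nat \<Rightarrow> nat \<Rightarrow> bool" where
  "dumbbell_arc k k' l i j \<longleftrightarrow> j = Suc i \<or> Suc i = k \<and> j = 0 \<or> Suc i = k + k' + l \<and> j = k + l"

definition dumbbell :: "nat \<Rightarrow> nat \<Rightarrow> nat \<Rightarrow> nat pair_pre_digraph" where
  "dumbbell k k' l =
     \<lparr>pverts = {..<k + k' + l},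
      parcs = {(i, j). i < k + k' + l \<and> j < k + k' + l \<and>
        (dumbbell_arc k k' l i j \<or> dumbbell_arc k k' l j i)}\<rparr>"

lemma pverts_dumbbell [simp]: "pverts (dumbbell k k' l) = {..<k + k' + l}"
  by (simp add: dumbbell_def)

lemma in_parcs_dumbbell_iff:
  "(i, j) \<in> parcs (dumbbell k k' l) \<longleftrightarrow> i < k + k' + l \<and> j < k + k' + l \<and>
     (dumbbell_arc k k' l i j \<or> dumbbell_arc k k' l j i)"
  by (simp add: dumbbell_def)

lemma pair_graph_dumbbell:
  assumes "2 \<le> k" "2 \<le> k'"
  shows "pair_graph (dumbbell k k' l)"
  using assms by (auto simp: pair_graph_iff irrefl_def sym_def in_parcs_dumbbell_iff dumbbell_arc_def)

lemma induced_cycle_dumbbell_left: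
  assumes "3 \<le> k"
  shows "induced_cycle (dumbbell k k' l) {..<k}"
proof -
  have "induced_embedding id (cycle_graph k) (dumbbell k k' l)"
    using assms by (intro induced_embeddingI)
      (auto simp: in_parcs_dumbbell_iff dumbbell_arc_def mod_Suc)
  then show ?thesis using induced_embedding_imp_induced_cycle(1)[of id] assms by simp
qed

lemma induced_cycle_dumbbell_right:
  assumes "3 \<le> k'"
  shows "induced_cycle (dumbbell k k' l) {k + l..<k + k' + l}"
proof -
  have "induced_embedding ((+) (k + l)) (cycle_graph k') (dumbbell k k' l)"
    using assms by (intro induced_embeddingI)
      (auto simp: in_parcs_dumbbell_iff dumbbell_arc_def mod_Suc)
  moreover have "(+) (k + l) ` {..<k'} = {k + l..<k + k' + l}"
    by (simp add: lessThan_atLeast0 add_ac)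
  ultimately show ?thesis using induced_embedding_imp_induced_cycle(1) assms by metis
qed

lemma induced_cycle_dumbbell_eq_left:
  assumes lengths_ge: "3 \<le> k" "3 \<le> k'" and cycle: "induced_cycle (dumbbell k k' l) S" and "0 \<in> S"
  shows "S = {..<k}"
proof -
  have "Suc 0 \<in> S"
    by (rule induced_cycle_neighbours[OF cycle \<open>0 \<in> S\<close>, of _ "k - 1"])
      (use lengths_ge in \<open>auto simp: in_parcs_dumbbell_iff dumbbell_arc_def\<close>)
  have "i \<in> S" if "i < k" "0 < i" for i
    using that(2,1)
  proof (induction i rule: nat_induct_non_zero)
    case (Suc i)
    show ?case
      by (rule induced_cycle_neighbours[OF cycle Suc.IH, of _ "i - 1"])
        (use Suc lengths_ge in \<open>auto simp: in_parcs_dumbbell_iff dumbbell_arc_def\<close>)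
  qed (use \<open>Suc 0 \<in> S\<close> in simp)
  then have "{..<k} \<subseteq> S" using \<open>0 \<in> S\<close> by (auto intro: gr0I)
  then show ?thesis
    using induced_cycle_subset_eq[OF cycle induced_cycle_dumbbell_left[OF lengths_ge(1)]] by simp
qed

lemma has_hole_dumbbell:
  assumes lengths_ge: "3 \<le> k" "3 \<le> k'" and "has_hole (dumbbell k k' l) c"
  shows "c = k \<or> c = k'"
proof -
  obtain S where cycle: "induced_cycle (dumbbell k k' l) S"
    and card: "card S = c" and sub: "S \<subseteq> {..<k + k' + l}"
    using assms(3) by (metis has_hole_imp_induced_cycle pverts_dumbbell)
  define x where "x = Min S"
  have "x \<in> S" and x_le: "\<And>z. z \<in> S \<Longrightarrow> x \<le> z"
    using induced_cycle_finite[OF cycle] induced_cycle_nonempty[OF cycle] by (auto simp: x_def)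
  have "x = 0 \<or> x = k + l"
  proof (rule ccontr)
    assume "\<not> (x = 0 \<or> x = k + l)"
    then have "z = Suc x" if "z \<in> S" "(x, z) \<in> parcs (dumbbell k k' l)" for z
      using that x_le[OF that(1)] by (auto simp: in_parcs_dumbbell_iff dumbbell_arc_def)
    then show False using induced_cycle_neighbours(3)[OF cycle \<open>x \<in> S\<close>] by blast
  qed
  then show ?thesis
  proof
    assume "x = 0"
    then show ?thesis
      using induced_cycle_dumbbell_eq_left[OF lengths_ge cycle] \<open>x \<in> S\<close> card by simp
  next
    assume "x = k + l"
    then have "S \<subseteq> {k + l..<k + k' + l}" using x_le sub by auto
    then have "S = {k + l..<k + k' + l}"
      by (rule induced_cycle_subset_eq[OF induced_cycle_dumbbell_right[OF lengths_ge(2)] cycle])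
    then show ?thesis using card by simp
  qed
qed

text \<open>The closed walk that traverses the path from \<open>0\<close> to \<open>k + k' + l - 1\<close>, takes the chord to
  \<open>k + l\<close>, goes back along the path to \<open>k - 1\<close> and closes up with the chord to \<open>0\<close>.\<close>

definition dumbbell_walk :: "nat \<Rightarrow> nat \<Rightarrow> nat \<Rightarrow> nat \<Rightarrow> nat" where
  "dumbbell_walk k k' l t = (if t < k + k' + l then t else 2 * k + k' + 2 * l - t)"

lemma dumbbell_walk_less: "0 < k' \<Longrightarrow> dumbbell_walk k k' l t < k + k' + l"
  by (auto simp: dumbbell_walk_def)

lemma dumbbell_walk_step:
  assumes "0 < k" "0 < k'" "t < k + k' + 2 * l + 2"
  shows "(dumbbell_walk k k' l t, dumbbell_walk k k' l (Suc t mod (k + k' + 2 * l + 2)))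
    \<in> parcs (dumbbell k k' l)"
proof -
  consider "Suc t < k + k' + l" | "Suc t = k + k' + l"
    | "k + k' + l \<le> t" "Suc t < k + k' + 2 * l + 2" | "Suc t = k + k' + 2 * l + 2"
    using assms(3) by linarith
  then show ?thesis
    using assms(1,2)
    by cases (auto simp: in_parcs_dumbbell_iff dumbbell_arc_def dumbbell_walk_def)
qed

lemma dumbbell_walk_window:
  fixes k k' l N x d :: nat
  defines "q \<equiv> k + k' + 2 * l + 2"
  defines "y \<equiv> (x + d) mod q"
  assumes "N < k" "N < k'" "x < q" "0 < d" "d < N"
  shows "dumbbell_walk k k' l x \<noteq> dumbbell_walk k k' l y"
    and "(dumbbell_walk k k' l x, dumbbell_walk k k' l y) \<in> parcs (dumbbell k k' l) \<Longrightarrow> d = 1"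
proof -
  let ?\<phi> = "dumbbell_walk k k' l"
  have walk_cases: "t < k + k' + l \<and> ?\<phi> t = t \<or> k + k' + l \<le> t \<and> ?\<phi> t + t = 2 * k + k' + 2 * l"
    if "t < q" for t
    using that \<open>N < k\<close> by (auto simp: dumbbell_walk_def q_def)
  have "y < q" "d < q" using assms(3-7) by (auto simp: y_def q_def)
  have y_cases: "y = x + d \<and> x + d < q \<or> y + q = x + d \<and> q \<le> x + d"
    using \<open>x < q\<close> \<open>d < q\<close> by (cases "x + d < q") (auto simp: y_def le_mod_geq)
  note walk_bounds = walk_cases[OF \<open>x < q\<close>] walk_cases[OF \<open>y < q\<close>] y_cases assms(3-7)
  show "?\<phi> x \<noteq> ?\<phi> y"
    using walk_bounds unfolding q_def by linarith
  show "d = 1" if "(?\<phi> x, ?\<phi> y) \<in> parcs (dumbbell k k' l)"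
    using that walk_bounds unfolding in_parcs_dumbbell_iff dumbbell_arc_def q_def
    by (elim disjE conjE) linarith+
qed

lemma induced_embedding_dumbbell_walk:
  assumes lengths_ge: "3 \<le> k" "3 \<le> k'" and lengths_gt: "N < k" "N < k'"
  shows "induced_embedding (\<lambda>s. dumbbell_walk k k' l ((r + s) mod (k + k' + 2 * l + 2)))
    (path_graph N) (dumbbell k k' l)"
proof (rule induced_embedding_path_graphI)
  show "pair_graph (dumbbell k k' l)" using lengths_ge by (intro pair_graph_dumbbell) auto
  let ?q = "k + k' + 2 * l + 2"
  let ?\<phi> = "\<lambda>s. dumbbell_walk k k' l ((r + s) mod ?q)"
  show "?\<phi> s \<in> pverts (dumbbell k k' l)" for s
    using dumbbell_walk_less lengths_ge by simp
  fix s s' assume "s < s'" "s' < N"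
  have start: "(r + s) mod ?q < ?q" by simp
  from \<open>s < s'\<close> \<open>s' < N\<close> obtain d where s'_eq: "s' = s + d" and "0 < d" "d < N"
    using less_imp_add_positive[of s s'] by auto
  have shift: "(r + s') mod ?q = ((r + s) mod ?q + d) mod ?q"
    by (simp only: s'_eq mod_add_left_eq add.assoc)
  note window = dumbbell_walk_window[OF lengths_gt start \<open>0 < d\<close> \<open>d < N\<close>, folded shift]
  have "(?\<phi> s, ?\<phi> s') \<in> parcs (dumbbell k k' l)" if "s' = Suc s"
    using dumbbell_walk_step[OF _ _ start] lengths_ge by (simp add: that mod_Suc_eq)
  moreover have "s' = Suc s" if "(?\<phi> s, ?\<phi> s') \<in> parcs (dumbbell k k' l)"
    using window(2)[OF that] s'_eq by simp
  ultimately show "?\<phi> s \<noteq> ?\<phi> s' \<and> ((?\<phi> s, ?\<phi> s') \<in> parcs (dumbbell k k' l) \<longleftrightarrow> s' = Suc s)"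
    using window(1) by blast
qed

section \<open>Cycle lengths of expressible classes\<close>

lemma admits_free_orientation_if_no_holes:
  fixes G :: "'a pair_pre_digraph"
  assumes nat_graphs: "\<forall>H\<in>graphs_without_holes C. admits_free_orientation F H"
    and graph: "pair_graph G" and no_holes: "\<And>c. has_hole G c \<Longrightarrow> c \<notin> C"
  shows "admits_free_orientation F G"
proof -
  obtain f where bij: "bij_betw f {0..<card (pverts G)} (pverts G)"
    using graph ex_bij_betw_nat_finite by (auto simp: pair_graph_iff)
  let ?H = "pullback f {0..<card (pverts G)} G"
  have H_graph: "pair_graph ?H" by (rule pair_graph_pullback[OF graph]) simp
  have emb: "induced_embedding f ?H G" "f ` pverts ?H = pverts G"
    using bij by (auto simp: bij_betw_def intro!: induced_embeddingI)
  have wf: "pair_wf_digraph G" "pair_wf_digraph ?H"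
    using graph H_graph by (auto intro: pair_graph_imp_pair_wf_digraph)
  then have GH: "has_induced_copy G ?H" and HG: "has_induced_copy ?H G"
    using emb induced_embedding_inv_into[OF emb] by (auto simp: has_induced_copy_iff)
  have "has_hole G c" if "has_hole ?H c" for c
    using that has_induced_copy_trans[OF GH] by (auto simp: has_hole_def)
  then have "?H \<in> graphs_without_holes C"
    using H_graph no_holes by (auto simp: graphs_without_holes_def)
  then show ?thesis
    using nat_graphs admits_free_orientation_induced_copy[OF _ HG] by blast
qed

lemma admits_free_orientation_copies_if_no_holes:
  assumes "\<forall>H\<in>graphs_without_holes C. admits_free_orientation F H"
    and "pair_graph G" and no_holes: "\<And>c. has_hole G c \<Longrightarrow> c \<notin> C"
  shows "admits_free_orientation F (copies m G)"
proof (rule admits_free_orientation_if_no_holes[OF assms(1)])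
  show "pair_graph (copies m G)" using assms(2) by (intro pair_graph_disjoint_union) auto
  show "c \<notin> C" if "has_hole (copies m G) c" for c
    using has_hole_disjoint_union[OF that] no_holes by blast
qed

lemma cycle_graph_in_graphs_without_holes_iff:
  "4 \<le> k \<Longrightarrow> cycle_graph k \<in> graphs_without_holes C \<longleftrightarrow> k \<notin> C"
  by (auto simp: graphs_without_holes_def has_hole_cycle_graph_iff pair_graph_cycle_graph)

lemma expressible_imp_cycle_lengths:
  assumes "expressible_by_forbidden_orientations (graphs_without_holes C)"
  obtains N where "\<exists>k>N. k \<notin> C"
    "\<And>k k' l. \<lbrakk>N < k; N < k'; k \<notin> C; k' \<notin> C\<rbrakk> \<Longrightarrow> k + k' + 2 * l + 2 \<notin> C"
proof -
  obtain F :: "nat pair_pre_digraph set" where "finite F"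
    and class_iff: "\<And>G. pair_graph G \<Longrightarrow> G \<in> graphs_without_holes C \<longleftrightarrow> admits_free_orientation F G"
    using assms unfolding expressible_by_forbidden_orientations_def admits_free_orientation_def by blast
  have "finite (insert 3 ((\<lambda>H. card (pverts H)) ` F))" using \<open>finite F\<close> by simp
  then obtain N where "3 \<le> N" and card_le: "\<forall>H\<in>F. card (pverts H) \<le> N"
    unfolding finite_nat_set_iff_bounded_le by auto
  have nat_graphs: "\<forall>H\<in>graphs_without_holes C. admits_free_orientation F H"
    using class_iff by (auto simp: graphs_without_holes_def)
  note copies = admits_free_orientation_copies_if_no_holes[OF nat_graphs]
  have cycle_length: "q \<notin> C" if "admits_free_orientation F (cycle_graph q)" "4 \<le> q" for q
    using that class_iff[of "cycle_graph q"] pair_graph_cycle_graph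
      cycle_graph_in_graphs_without_holes_iff by simp
  show thesis
  proof (rule that[of N])
    have "\<exists>q>N. 3 \<le> q \<and> admits_free_orientation F (cycle_graph q)"
      using copies[OF pair_graph_path_graph] not_has_hole_path_graph
      by (intro admits_free_orientation_long_cycle_graph[OF card_le]) blast
    then show "\<exists>k>N. k \<notin> C" using cycle_length \<open>3 \<le> N\<close> by force
    fix k k' l assume lengths_gt: "N < k" "N < k'" and "k \<notin> C" "k' \<notin> C"
    have lengths_ge: "3 \<le> k" "3 \<le> k'" using lengths_gt \<open>3 \<le> N\<close> by auto
    have "pair_graph (dumbbell k k' l)" using lengths_ge by (intro pair_graph_dumbbell) auto
    moreover from this have "admits_free_orientation F (copies m (dumbbell k k' l))" for m
      using has_hole_dumbbell[OF lengths_ge] \<open>k \<notin> C\<close> \<open>k' \<notin> C\<close> by (intro copies) auto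
    ultimately have "admits_free_orientation F (cycle_graph (k + k' + 2 * l + 2))"
      using induced_embedding_dumbbell_walk[OF lengths_ge lengths_gt] lengths_gt lengths_ge
      by (intro admits_free_orientation_cycle_graph[OF card_le]) auto
    then show "k + k' + 2 * l + 2 \<notin> C" using cycle_length lengths_ge by simp
  qed
qed

lemma finite_or_eventually_odd:
  fixes C :: "nat set"
  assumes "\<exists>k>N. k \<notin> C"
    and closed: "\<And>k k' l. \<lbrakk>N < k; N < k'; k \<notin> C; k' \<notin> C\<rbrakk> \<Longrightarrow> k + k' + 2 * l + 2 \<notin> C"
  shows "finite C \<or> (\<forall>\<^sub>F n in sequentially. n \<in> C \<longleftrightarrow> odd n)"
proof -
  have same_parity: "n \<notin> C"
    if "N < k" "N < k'" "k \<notin> C" "k' \<notin> C" "k + k' + 2 \<le> n" "even (k + k' + n)" for k k' n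
  proof -
    have "n = k + k' + 2 * ((n - (k + k' + 2)) div 2) + 2" using that(5,6) by presburger
    then show ?thesis using closed[OF that(1-4)] by metis
  qed
  obtain k where "N < k" "k \<notin> C" using assms(1) by blast
  define M where "M = 2 * k + 2"
  have even: "n \<notin> C" if "even n" "M \<le> n" for n
    using same_parity[OF \<open>N < k\<close> \<open>N < k\<close> \<open>k \<notin> C\<close> \<open>k \<notin> C\<close>] that by (simp add: M_def)
  show ?thesis
  proof (cases "\<exists>k'\<ge>M. odd k' \<and> k' \<notin> C")
    case True
    then obtain k' where "odd k'" "M \<le> k'" "k' \<notin> C" by blast
    have "N < M" "even M" using \<open>N < k\<close> by (auto simp: M_def)
    then have "n \<notin> C" if "odd n" "M + k' + 2 \<le> n" for n
      using same_parity[OF \<open>N < M\<close> _ even \<open>k' \<notin> C\<close>] that \<open>odd k'\<close> \<open>M \<le> k'\<close> by simp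
    with even have "C \<subseteq> {..<M + k' + 2}"
      by (metis add_leD1 lessThan_iff not_le subsetI)
    then show ?thesis using finite_subset by blast
  next
    case False
    then have "\<forall>n\<ge>M. n \<in> C \<longleftrightarrow> odd n" using even by blast
    then show ?thesis by (auto simp: eventually_sequentially)
  qed
qed

lemma from_on_eq_iff_eventually:
  "(\<exists>M>0. from_on B M = {n. P n \<and> n \<ge> M}) \<longleftrightarrow> (\<forall>\<^sub>F n in sequentially. n \<in> B \<longleftrightarrow> P n)"
proof
  assume "\<forall>\<^sub>F n in sequentially. n \<in> B \<longleftrightarrow> P n"
  then obtain M where "\<forall>n\<ge>M. n \<in> B \<longleftrightarrow> P n" by (auto simp: eventually_sequentially)
  then have "from_on B (Suc M) = {n. P n \<and> n \<ge> Suc M}" by (auto simp: from_on_def)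
  then show "\<exists>M>0. from_on B M = {n. P n \<and> n \<ge> M}" by blast
qed (auto simp: eventually_sequentially from_on_def set_eq_iff)

lemma eventually_mem_cyc_iff:
  "\<forall>\<^sub>F k in sequentially. k \<in> cyc (graphs_without_holes C) \<longleftrightarrow> k \<notin> C"
  unfolding eventually_sequentially
  by (rule exI[of _ 4]) (simp add: cyc_def cycle_graph_in_graphs_without_holes_iff)

theorem theorem17:
  fixes C :: "nat set"
  assumes "\<forall>c\<in>C. c > 0"
  shows "(expressible_by_forbidden_orientations (graphs_without_holes C) \<longrightarrow>
            finite C \<or> (\<exists>M>0. from_on C M = {n. odd n \<and> n \<ge> M}))
       \<and> ((\<exists>M>0. from_on C M = {n. odd n \<and> n \<ge> M}) \<longleftrightarrow>
          (\<exists>M>0. from_on (cyc (graphs_without_holes C)) M = {n. even n \<and> n \<ge> M}))"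
  unfolding from_on_eq_iff_eventually
proof (intro conjI impI)
  assume "expressible_by_forbidden_orientations (graphs_without_holes C)"
  then show "finite C \<or> (\<forall>\<^sub>F n in sequentially. n \<in> C \<longleftrightarrow> odd n)"
    by (rule expressible_imp_cycle_lengths) (rule finite_or_eventually_odd)
next
  have "\<forall>\<^sub>F n in sequentially.
      (n \<in> C \<longleftrightarrow> odd n) \<longleftrightarrow> (n \<in> cyc (graphs_without_holes C) \<longleftrightarrow> even n)"
    using eventually_mem_cyc_iff[of C] by eventually_elim blast
  then show "(\<forall>\<^sub>F n in sequentially. n \<in> C \<longleftrightarrow> odd n) \<longleftrightarrow>
      (\<forall>\<^sub>F n in sequentially. n \<in> cyc (graphs_without_holes C) \<longleftrightarrow> even n)"
    by (rule eventually_subst)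
qed

end
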